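(* For every integer $s\ge 4$ there is a constant $c=c(s)>0$ such that for all integers $n\ge1$, $$f_{s,s+2}(n)\le c\sqrt{n}.$$
   Context: For integers $2\le s<t$ and $n\ge1$, $f_{s,t}(n)$ denotes the minimum, over all $K_t$-free graphs $G$ on $n$ vertices, of the maximum size of a set $W\subseteq V(G)$ such that the induced subgraph $G[W]$ contains no copy of $K_s$. *)

theory Defs
  imports Complex_Main "Graph_Theory.Kuratowski"
begin

text \<open>
  A simple graph is a \<^locale>\<open>pair_graph\<close>: a finite, loop-free, symmetric digraph whose arcs are
  pairs of vertices, so that an undirected edge appears as two opposite arcs.
\<close>

definition contains_complete :: "nat \<Rightarrow> ('a, 'b) pre_digraph \<Rightarrow> bool" where
  "contains_complete r G \<longleftrightarrow> (\<exists>H. subgraph H G \<and> K\<^bsub>r\<^esub> H)"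

definition free_number :: "nat \<Rightarrow> 'a pair_pre_digraph \<Rightarrow> nat" where
  "free_number s G =
     Max (card ` {W. W \<subseteq> pverts G \<and> \<not> contains_complete s (with_proj G \<restriction> W)})"

text \<open>
  Fixing \<^typ>\<open>nat\<close> as the type of vertices loses nothing, since every finite graph is isomorphic
  to a graph on natural numbers.
\<close>

definition free_graphs :: "nat \<Rightarrow> nat \<Rightarrow> nat pair_pre_digraph set" where
  "free_graphs t n =
     {G. pair_graph G \<and> card (pverts G) = n \<and> \<not> contains_complete t (with_proj G)}"

definition erdos_rogers :: "nat \<Rightarrow> nat \<Rightarrow> nat \<Rightarrow> nat" where
  "erdos_rogers s t n = Min (free_number s ` free_graphs t n)"

text \<open>
  The following facts show that the maximum and the minimum above range over finite nonempty sets.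
\<close>

lemma contains_complete_card_le:
  assumes "contains_complete r G" "finite (verts G)"
  shows "r \<le> card (verts G)"
  using assms unfolding contains_complete_def complete_digraph_def
  by (metis card_mono subgraph_imp_subverts)

lemma free_number_sets_finite:
  assumes "pair_graph G"
  shows "finite {W. W \<subseteq> pverts G \<and> \<not> contains_complete s (with_proj G \<restriction> W)}"
proof -
  interpret pair_graph G by fact
  show ?thesis using pair_finite_verts by simp
qed

lemma free_number_sets_nonempty:
  assumes "1 \<le> s"
  shows "{W. W \<subseteq> pverts G \<and> \<not> contains_complete s (with_proj G \<restriction> W)} \<noteq> {}"
proof -
  have "\<not> contains_complete s (with_proj G \<restriction> {})"
    using contains_complete_card_le[of s "with_proj G \<restriction> {}"] assms by auto
  then show ?thesis by blast
qed

lemma free_number_le: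
  assumes "pair_graph G" "1 \<le> s"
  shows "free_number s G \<le> card (pverts G)"
proof -
  interpret pair_graph G by fact
  show ?thesis
    unfolding free_number_def
    using free_number_sets_finite[OF assms(1), of s] free_number_sets_nonempty[OF assms(2), of G]
    by (auto intro: card_mono pair_finite_verts)
qed

lemma free_number_image_finite:
  assumes "1 \<le> s"
  shows "finite (free_number s ` free_graphs t n)"
proof (rule finite_subset)
  show "free_number s ` free_graphs t n \<subseteq> {..n}"
    using free_number_le[OF _ assms] by (auto simp: free_graphs_def)
qed simp

lemma free_graphs_nonempty:
  assumes "2 \<le> t"
  shows "free_graphs t n \<noteq> {}"
proof -
  define G :: "nat pair_pre_digraph" where "G = \<lparr>pverts = {..<n}, parcs = {}\<rparr>"
  have "pair_graph G"
    by unfold_locales (auto simp: G_def symmetric_def)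
  moreover have "\<not> contains_complete t (with_proj G)"
  proof
    assume "contains_complete t (with_proj G)"
    then obtain H where H: "subgraph H (with_proj G)" "K\<^bsub>t\<^esub> H"
      by (auto simp: contains_complete_def)
    have "arcs H = {}"
      using H(1) by (auto simp: subgraph_def G_def)
    then have "{(u, v). (u, v) \<in> verts H \<times> verts H \<and> u \<noteq> v} = {}"
      using H(2) by (simp add: complete_digraph_def arcs_ends_def)
    moreover have "1 < card (verts H)"
      using H(2) assms by (simp add: complete_digraph_def)
    then obtain u v where "u \<in> verts H" "v \<in> verts H" "u \<noteq> v"
      by (metis One_nat_def card_le_Suc0_iff_eq card.infinite not_less not_less_zero)
    ultimately show False by blast
  qed
  moreover have "card (pverts G) = n" by (simp add: G_def)
  ultimately show ?thesis by (auto simp: free_graphs_def)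
qed

end

theory Submission
  imports Defs "HOL-Algebra.Algebraic_Closure_Type" "HOL-Real_Asymp.Real_Asymp"
    "Berlekamp_Zassenhaus.Finite_Field"
begin

text \<open>
  The vertices are points of the plane over a field with \<open>q = 3^m\<close> elements, where
  \<open>n \<le> q\<^sup>2 < 9 n\<close>. Choose a set \<open>S\<close> of slopes with \<open>card S\<close> of order \<open>log q\<close> such that no four
  points in general position have all six connecting slopes in \<open>S\<close>; a greedy choice succeeds,
  because \<open>k\<close> slopes block only \<open>O(k\<^sup>5)\<close> further ones. Colour each point, once for every slope in
  \<open>S\<close>, with one of \<open>s\<close> colours, and join two points if their slope \<open>a\<close> lies in \<open>S\<close> and their
  colours for \<open>a\<close> differ.

  Of \<open>s + 2\<close> pairwise joined points, either four are in general position or \<open>s + 1\<close> are collinear,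
  and two of the latter would share a colour. On the other hand, a set \<open>W\<close> that contains no
  \<open>K\<^sub>s\<close> misses a colour on each line with slope in \<open>S\<close>. Let \<open>k\<close> be the size of \<open>S\<close>, let
  \<open>s (1 - 1/s)^D \<le> 1\<close> and \<open>w = 2 D q\<close>. A random
  colouring does this for a given \<open>W\<close> of size \<open>w\<close> with probability at most
  \<open>(s^q (1 - 1/s)^w)^k \<le> (1 - 1/s)^(k D q)\<close>, which beats the number \<open>q^(4 D q)\<close> of such sets since
  \<open>k\<close> is of order \<open>log q\<close>.
\<close>

section \<open>Fields of order \<open>3^m\<close>\<close>

text \<open>The polynomial \<open>x ^ q - x\<close> splits, and its derivative is \<open>-1\<close>
  because \<open>q\<close> vanishes in the field. Hence no root is repeated and there are
  \<open>q\<close> of them.\<close>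

lemma card_frobenius_fixed_points:
  assumes "prime CHAR('a::alg_closed_field)" "1 \<le> m" "q = CHAR('a) ^ m"
  shows "card {x::'a. x ^ q = x} = q"
proof -
  define p :: "'a poly" where "p = monom 1 q - monom 1 1"
  have q: "1 < q"
    using assms one_less_power[OF prime_gt_1_nat[OF assms(1)], of m] by simp
  have deg: "degree p = q"
    unfolding p_def using q by (subst diff_conv_add_uminus, subst degree_add_eq_left)
      (auto simp: degree_monom_eq)
  have p0: "p \<noteq> 0" using deg q by auto
  have lc: "lead_coeff p = 1" unfolding deg using q by (simp add: p_def)
  from alg_closed_imp_factorization[OF p0] obtain A
    where A': "size A = degree p \<and> p = smult (lead_coeff p) (\<Prod>x\<in>#A. [:-x, 1:])" ..
  have A: "size A = q" "p = (\<Prod>x\<in>#A. [:-x, 1:])"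
    using A'[THEN conjunct1, unfolded deg] A'[THEN conjunct2, unfolded lc smult_1_left] .
  have "of_nat q = (0::'a)"
    using assms by (simp add: of_nat_eq_0_iff_char_dvd)
  then have pd: "pderiv p = -1"
    by (simp add: p_def pderiv_diff pderiv_monom monom_0 one_pCons)
  have "count A x \<le> 1" for x
  proof (rule ccontr)
    assume "\<not> count A x \<le> 1"
    then have "x \<in># A" "x \<in># A - {#x#}"
      by (auto simp: in_diff_count intro: count_inI)
    then obtain B where B: "A = add_mset x (add_mset x B)"
      by (metis insert_DiffM)
    have "p = [:-x, 1:] * ([:-x, 1:] * (\<Prod>x\<in>#B. [:-x, 1:]))"
      unfolding A(2) B by (simp only: image_mset_add_mset prod_mset.add_mset)
    then have "poly (pderiv p) x = 0"
      by (simp only: pderiv_mult poly_add poly_mult) simp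
    then show False using pd by simp
  qed
  then have "A = mset_set (set_mset A)"
    by (intro multiset_eqI) (metis One_nat_def count_greater_eq_one_iff count_mset_set(1) count_mset_set(3)
        finite_set_mset le_antisym not_in_iff)
  then have "card (set_mset A) = q" using A(1) by (metis size_mset_set)
  moreover have "poly p x = 0 \<longleftrightarrow> x \<in> set_mset A" for x
    unfolding A(2) poly_prod_mset by (auto simp: prod_mset_zero_iff image_iff)
  ultimately show ?thesis
    by (simp add: p_def poly_monom)
qed

text \<open>\<open>mod_ring\<close> takes its modulus from the size of a type. The prime 3 rather
  than 2 keeps \<open>2 \<noteq> 0\<close>, on which \<open>card_parallel_slopes\<close>
  rests.\<close>

datatype three = Zero | One | Two

lemma CARD_three [simp]: "CARD(three) = 3"
proof -
  have "UNIV = {Zero, One, Two}"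
    using three.exhaust by auto
  then have "CARD(three) = card {Zero, One, Two}" by (rule arg_cong)
  then show ?thesis by simp
qed

instance three :: prime_card
  by standard simp

lemma char_three: "CHAR(three mod_ring alg_closure) = 3"
  by simp

text \<open>The closure property says that the line of slope \<open>a\<close> through
  \<open>(x, y)\<close> has its intercept in \<open>F\<close>. It follows from additivity of the
  Frobenius power, whose exponent is odd.\<close>

lemma finite_field_three_power:
  assumes "1 \<le> m"
  obtains F :: "three mod_ring alg_closure set"
  where "card F = 3 ^ m" "\<And>a x y. a \<in> F \<Longrightarrow> x \<in> F \<Longrightarrow> y \<in> F \<Longrightarrow> y - a * x \<in> F"
proof
  let ?F = "{x::three mod_ring alg_closure. x ^ 3 ^ m = x}"
  have ch: "prime CHAR(three mod_ring alg_closure)" by (simp add: char_three)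
  show "card ?F = 3 ^ m"
    by (rule card_frobenius_fixed_points[OF ch assms]) (simp add: char_three)
  fix a x y assume *: "a \<in> ?F" "x \<in> ?F" "y \<in> ?F"
  have "(y + (- a) * x) ^ 3 ^ m = y ^ 3 ^ m + ((- a) * x) ^ 3 ^ m"
    by (rule freshmans_dream'[OF ch]) (simp add: char_three)
  also have "\<dots> = y - a * x" using * by (simp add: power_mult_distrib)
  finally show "y - a * x \<in> ?F" by simp
qed

lemma two_neq_zero: "(2::three mod_ring alg_closure) \<noteq> 0"
  using of_nat_eq_0_iff_char_dvd[of 2, where ?'a="three mod_ring alg_closure"] by (auto simp: char_three dest: dvd_imp_le)

section \<open>Slope sets without quadrangles\<close>

definition slope :: "'a::field \<times> 'a \<Rightarrow> 'a \<times> 'a \<Rightarrow> 'a" where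
  "slope p q = (snd q - snd p) / (fst q - fst p)"

text \<open>Division by zero gives vertical pairs the slope 0, so a separate condition excludes
  them.\<close>

definition linked :: "'a::field set \<Rightarrow> 'a \<times> 'a \<Rightarrow> 'a \<times> 'a \<Rightarrow> bool" where
  "linked S p q \<longleftrightarrow> fst p \<noteq> fst q \<and> slope p q \<in> S"

definition noncollinear :: "'a::field \<times> 'a \<Rightarrow> 'a \<times> 'a \<Rightarrow> 'a \<times> 'a \<Rightarrow> bool" where
  "noncollinear p q r \<longleftrightarrow>
     (fst q - fst p) * (snd r - snd p) \<noteq> (fst r - fst p) * (snd q - snd p)"

definition quadrangle where
  "quadrangle S p q r t \<longleftrightarrow>
     linked S p q \<and> linked S p r \<and> linked S p t \<and> linked S q r \<and> linked S q t \<and> linked S r t \<and>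
     noncollinear p q r \<and> noncollinear p q t \<and> noncollinear p r t \<and> noncollinear q r t"

definition quadrangle_free where
  "quadrangle_free S \<longleftrightarrow> (\<nexists>p q r t. quadrangle S p q r t)"

lemma slope_commute: "slope p q = slope q p"
  unfolding slope_def by (metis minus_diff_eq minus_divide_divide)

lemma linked_commute: "linked S p q \<longleftrightarrow> linked S q p"
  unfolding linked_def by (auto simp: slope_commute)

lemma noncollinear_commute:
  "noncollinear p q r \<longleftrightarrow> noncollinear q p r"
  "noncollinear p q r \<longleftrightarrow> noncollinear p r q"
  unfolding noncollinear_def by (auto simp: algebra_simps)

lemma slope_neq:
  assumes "noncollinear p q r" "fst p \<noteq> fst q" "fst p \<noteq> fst r"
  shows "slope p q \<noteq> slope p r"
  using assms unfolding noncollinear_def slope_def by (auto simp: frac_eq_eq mult.commute)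

lemma noncollinearI:
  assumes "slope p q \<noteq> slope p r" "fst p \<noteq> fst q" "fst p \<noteq> fst r"
  shows "noncollinear p q r"
  using assms unfolding noncollinear_def slope_def by (auto simp: frac_eq_eq mult.commute)

text \<open>These adjacent transpositions generate all permutations, so any side can be moved to the
  place of the last one.\<close>

lemma quadrangle_commute:
  "quadrangle S p q r t \<Longrightarrow> quadrangle S q p r t"
  "quadrangle S p q r t \<Longrightarrow> quadrangle S p r q t"
  "quadrangle S p q r t \<Longrightarrow> quadrangle S p q t r"
  unfolding quadrangle_def using linked_commute noncollinear_commute by metis+

text \<open>
  The slope of the line through \<open>c\<close> and \<open>d\<close> in terms of those of \<open>ab\<close>, \<open>ac\<close>, \<open>ad\<close>, \<open>bc\<close> and \<open>bd\<close>:
  after scaling so that \<open>fst b - fst a = 1\<close>, the two quotients are \<open>fst d - fst a\<close> and \<open>fst c - fst a\<close>.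
\<close>

definition sixth_slope :: "'a::field \<Rightarrow> 'a \<Rightarrow> 'a \<Rightarrow> 'a \<Rightarrow> 'a \<Rightarrow> 'a" where
  "sixth_slope o' p q r t =
     (q * ((o' - t) / (q - t)) - p * ((o' - r) / (p - r))) / ((o' - t) / (q - t) - (o' - r) / (p - r))"

text \<open>The candidates for the common slope of \<open>ab\<close> and \<open>cd\<close> if these are parallel.\<close>

definition parallel_slopes :: "'a::field \<Rightarrow> 'a \<Rightarrow> 'a \<Rightarrow> 'a \<Rightarrow> 'a set" where
  "parallel_slopes p q r t = {z. (p - r) * ((z - q) * (z - t)) = (q - t) * ((z - p) * (z - r))}"

text \<open>The rise from \<open>a\<close> to \<open>c\<close> is the rise from \<open>a\<close> to
  \<open>b\<close> plus that from \<open>b\<close> to \<open>c\<close>.\<close>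

lemma triangle_slopes:
  fixes a b c :: "'a::field \<times> 'a"
  assumes "fst a \<noteq> fst b" "fst a \<noteq> fst c" "fst b \<noteq> fst c"
  shows "(fst c - fst a) * (slope a c - slope b c) = (fst b - fst a) * (slope a b - slope b c)"
proof -
  have "slope a c * (fst c - fst a) = snd c - snd a" "slope a b * (fst b - fst a) = snd b - snd a"
    "slope b c * (fst c - fst b) = snd c - snd b"
    using assms by (auto simp: slope_def)
  then show ?thesis by Groebner_Basis.algebra
qed

lemma quadrangle_sixth_slope:
  fixes a b c d :: "'a::field \<times> 'a"
  assumes "quadrangle S a b c d"
  shows "slope c d = sixth_slope (slope a b) (slope a c) (slope a d) (slope b c) (slope b d)"
proof -
  define x where "x = (\<lambda>v::'a \<times> 'a. (fst v - fst a) / (fst b - fst a))"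
  have ne: "fst a \<noteq> fst b" "fst a \<noteq> fst c" "fst a \<noteq> fst d" "fst b \<noteq> fst c" "fst b \<noteq> fst d" "fst c \<noteq> fst d"
    using assms by (auto simp: quadrangle_def linked_def)
  have x: "x v = (slope a b - slope b v) / (slope a v - slope b v)"
    if "fst a \<noteq> fst v" "fst b \<noteq> fst v" "noncollinear a b v" for v
  proof -
    have "slope a v \<noteq> slope b v"
      using slope_neq[of v a b] that noncollinear_commute slope_commute by metis
    then show ?thesis
      using triangle_slopes[of a b v] that ne unfolding x_def by (simp add: frac_eq_eq mult.commute)
  qed
  have "slope c d = ((snd d - snd a) / (fst b - fst a) - (snd c - snd a) / (fst b - fst a))
      / ((fst d - fst a) / (fst b - fst a) - (fst c - fst a) / (fst b - fst a))"
    unfolding slope_def diff_divide_distrib[symmetric] using ne by simp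
  also have "\<dots> = (slope a d * x d - slope a c * x c) / (x d - x c)"
    using ne unfolding x_def slope_def by simp
  finally show ?thesis
    unfolding sixth_slope_def using x[of c] x[of d] ne assms
    by (simp add: quadrangle_def)
qed

text \<open>If two opposite sides share the new slope, \<open>sixth_slope\<close> has it among its
  own arguments. Eliminating the abscissas of \<open>c\<close> and \<open>d\<close> from three
  instances of \<open>triangle_slopes\<close> leaves an equation for it in terms of the other four
  slopes.\<close>

lemma quadrangle_parallel_slopes:
  assumes "quadrangle S a b c d" "slope a b = slope c d"
  shows "slope c d \<in> parallel_slopes (slope a c) (slope a d) (slope b c) (slope b d)"
proof -
  have x: "fst a \<noteq> fst b" "fst a \<noteq> fst c" "fst a \<noteq> fst d" "fst b \<noteq> fst c" "fst b \<noteq> fst d" "fst c \<noteq> fst d"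
    using assms by (auto simp: quadrangle_def linked_def)
  define z where "z = slope c d"
  note 1 = triangle_slopes[of a b c] triangle_slopes[of a b d] triangle_slopes[of a c d]
  have "(fst c - fst a) * (slope a c - slope b c) = (fst b - fst a) * (z - slope b c)"
    "(fst d - fst a) * (slope a d - slope b d) = (fst b - fst a) * (z - slope b d)"
    "(fst d - fst a) * (slope a d - z) = (fst c - fst a) * (slope a c - z)"
    using 1 x assms(2) by (auto simp: z_def)
  then have "(fst b - fst a) * ((slope a c - slope b c) * ((z - slope a d) * (z - slope b d)))
    = (fst b - fst a) * ((slope a d - slope b d) * ((z - slope a c) * (z - slope b c)))"
    by Groebner_Basis.algebra
  then show ?thesis using x unfolding parallel_slopes_def z_def by simp
qed

lemma card_parallel_slopes:
  fixes p :: "'a::field"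
  assumes "(2::'a) \<noteq> 0" "p \<noteq> q" "p \<noteq> r" "q \<noteq> t"
  shows "finite (parallel_slopes p q r t) \<and> card (parallel_slopes p q r t) \<le> 2"
proof -
  define P where "P = smult (p - r) ([:-q, 1:] * [:-t, 1:]) - smult (q - t) ([:-p, 1:] * [:-r, 1:])"
  have P: "poly P z = (p - r) * ((z - q) * (z - t)) - (q - t) * ((z - p) * (z - r))" for z
    unfolding P_def poly_diff poly_smult poly_mult by simp
  have eq: "parallel_slopes p q r t = {z. poly P z = 0}"
    by (simp add: parallel_slopes_def P)
  \<comment> \<open>The exceptional case is the parallelogram, whose diagonals are parallel in characteristic 2.\<close>
  have "P \<noteq> 0"
  proof (cases "p = t \<and> q = r")
    case True
    then have "P = smult (2 * (p - q)) ([:-q, 1:] * [:-p, 1:])"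
      unfolding P_def by (simp add: algebra_simps)
    then show ?thesis using assms by simp
  next
    case False
    \<comment> \<open>The value at \<open>p\<close> is \<open>(p - r) * (p - q) * (p - t)\<close>
      and at \<open>q\<close> it is \<open>- (q - t) * (q - p) * (q - r)\<close>.\<close>
    then have "poly P p \<noteq> 0 \<or> poly P q \<noteq> 0"
      using assms by (auto simp: P)
    then show ?thesis by auto
  qed
  moreover have "degree P \<le> 2"
    unfolding P_def by (intro degree_diff_le order.trans[OF degree_smult_le]) auto
  ultimately show ?thesis
    unfolding eq using card_poly_roots_bound[of P] poly_roots_finite[of P] by auto
qed

text \<open>The last part serves quadrangles in which a pair of opposite sides has the new slope.
  Its inequalities hold between sides meeting in a vertex and are those that bound
  \<open>parallel_slopes\<close>. Including \<open>S\<close> makes each chosen slope new.\<close>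

definition blocked_slopes :: "'a::field set \<Rightarrow> 'a set" where
  "blocked_slopes S = S \<union> (\<lambda>(o', p, q, r, t). sixth_slope o' p q r t) ` (S \<times> S \<times> S \<times> S \<times> S) \<union>
     (\<Union>(p, q, r, t) \<in> {(p, q, r, t) \<in> S \<times> S \<times> S \<times> S. p \<noteq> q \<and> p \<noteq> r \<and> q \<noteq> t}. parallel_slopes p q r t)"

lemma card_blocked_slopes:
  fixes S :: "'a::field set"
  assumes "finite S" "(2::'a) \<noteq> 0"
  shows "finite (blocked_slopes S) \<and> card (blocked_slopes S) \<le> 4 * card S ^ 5"
proof -
  let ?I = "{(p, q, r, t) \<in> S \<times> S \<times> S \<times> S. p \<noteq> q \<and> p \<noteq> r \<and> q \<noteq> t}"
  let ?A = "(\<lambda>(o', p, q, r, t). sixth_slope o' p q r t) ` (S \<times> S \<times> S \<times> S \<times> S)"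
  let ?B = "\<Union>(p, q, r, t) \<in> ?I. parallel_slopes p q r t"
  define k where "k = card S"
  have A: "finite ?A" "card ?A \<le> k ^ 5"
  proof -
    show "finite ?A" using assms by auto
    have "card ?A \<le> card (S \<times> S \<times> S \<times> S \<times> S)"
      using assms by (intro card_image_le) auto
    also have "\<dots> = k ^ 5" by (simp add: card_cartesian_product k_def numeral_eq_Suc)
    finally show "card ?A \<le> k ^ 5" .
  qed
  have I: "finite ?I" "card ?I \<le> k ^ 4"
  proof -
    show "finite ?I" by (rule finite_subset[of _ "S \<times> S \<times> S \<times> S"]) (use assms in auto)
    have "card ?I \<le> card (S \<times> S \<times> S \<times> S)"
      using assms by (intro card_mono) auto
    also have "\<dots> = k ^ 4" by (simp add: card_cartesian_product k_def numeral_eq_Suc)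
    finally show "card ?I \<le> k ^ 4" .
  qed
  have B: "finite ?B" "card ?B \<le> 2 * k ^ 4"
  proof -
    show "finite ?B" using I card_parallel_slopes[OF assms(2)] by auto
    have "card ?B \<le> (\<Sum>(p, q, r, t) \<in> ?I. card (parallel_slopes p q r t))"
      using card_UN_le[OF I(1)] by (simp add: case_prod_unfold)
    also have "\<dots> \<le> (\<Sum>(p, q, r, t) \<in> ?I. 2)"
      using card_parallel_slopes[OF assms(2)] by (intro sum_mono) auto
    also have "\<dots> = 2 * card ?I" by (simp add: case_prod_unfold)
    finally show "card ?B \<le> 2 * k ^ 4" using I(2) by linarith
  qed
  have eq: "blocked_slopes S = S \<union> ?A \<union> ?B" unfolding blocked_slopes_def ..
  have "card (S \<union> ?A \<union> ?B) \<le> card S + card ?A + card ?B"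
    using card_Un_le[of "S \<union> ?A" ?B] card_Un_le[of S ?A] by linarith
  also have "\<dots> \<le> k + k ^ 5 + 2 * k ^ 4" using A B k_def by linarith
  also have "\<dots> \<le> 4 * k ^ 5"
  proof (cases "k = 0")
    case False
    then have "k \<le> k ^ 5" "k ^ 4 \<le> k ^ 5"
      by (auto intro!: power_increasing self_le_power)
    then show ?thesis by simp
  qed simp
  finally show ?thesis unfolding eq k_def using A(1) B(1) assms(1) by simp
qed

text \<open>Sides meeting in a vertex have different slopes, so besides \<open>cd\<close> only the
  opposite side \<open>ab\<close> can have slope \<open>z\<close>. If it does, \<open>z\<close>
  solves the parallel equation; otherwise five slopes in \<open>S\<close> determine it.\<close>

lemma quadrangle_new_slope:
  assumes "quadrangle (insert z S) a b c d" "slope c d = z"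
  shows "z \<in> blocked_slopes S"
proof -
  have l: "fst a \<noteq> fst b" "fst a \<noteq> fst c" "fst a \<noteq> fst d" "fst b \<noteq> fst c" "fst b \<noteq> fst d" "fst c \<noteq> fst d"
    using assms by (auto simp: quadrangle_def linked_def)
  have n: "noncollinear a b c" "noncollinear a b d" "noncollinear a c d" "noncollinear b c d"
    using assms by (auto simp: quadrangle_def)
  have ne: "slope a c \<noteq> slope c d" "slope a d \<noteq> slope c d" "slope b c \<noteq> slope c d" "slope b d \<noteq> slope c d"
    "slope a c \<noteq> slope a d" "slope a c \<noteq> slope b c" "slope a d \<noteq> slope b d"
    using slope_neq[of c a d] slope_neq[of d a c] slope_neq[of c b d] slope_neq[of d b c]
      slope_neq[of a c d] slope_neq[of c a b] slope_neq[of d a b] l n noncollinear_commute slope_commute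
    by metis+
  have S: "slope a c \<in> S" "slope a d \<in> S" "slope b c \<in> S" "slope b d \<in> S" "slope a b \<in> insert z S"
    using assms ne by (auto simp: quadrangle_def linked_def)
  show ?thesis
  proof (cases "slope a b = z")
    case True
    then have "z \<in> parallel_slopes (slope a c) (slope a d) (slope b c) (slope b d)"
      using quadrangle_parallel_slopes[OF assms(1)] assms(2) by simp
    then show ?thesis unfolding blocked_slopes_def using S(1-4) ne by blast
  next
    case False
    then have "slope a b \<in> S" using S by auto
    moreover have "z = sixth_slope (slope a b) (slope a c) (slope a d) (slope b c) (slope b d)"
      using quadrangle_sixth_slope[OF assms(1)] assms(2) by simp
    ultimately show ?thesis unfolding blocked_slopes_def using S(1-4) by force
  qed
qed

lemma quadrangle_free_insert:
  assumes "quadrangle_free S" "z \<notin> blocked_slopes S"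
  shows "quadrangle_free (insert z S)"
  unfolding quadrangle_free_def
proof
  assume "\<exists>a b c d. quadrangle (insert z S) a b c d"
  then obtain a b c d where Q: "quadrangle (insert z S) a b c d" by blast
  have *: "slope r t \<noteq> z" if "quadrangle (insert z S) p q r t" for p q r t
    using quadrangle_new_slope[OF that] assms(2) by auto
  note sw = quadrangle_commute
  have "slope c d \<noteq> z" "slope b d \<noteq> z" "slope b c \<noteq> z" "slope a d \<noteq> z" "slope a c \<noteq> z"
    "slope a b \<noteq> z"
    using *[OF Q] *[OF sw(2)[OF Q]] *[OF sw(2)[OF sw(3)[OF Q]]] *[OF sw(2)[OF sw(1)[OF Q]]]
      *[OF sw(2)[OF sw(3)[OF sw(1)[OF Q]]]] *[OF sw(2)[OF sw(1)[OF sw(3)[OF sw(2)[OF Q]]]]]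
    by (simp_all add: slope_commute)
  then have "quadrangle S a b c d"
    using Q by (auto simp: quadrangle_def linked_def)
  then show False using assms(1) unfolding quadrangle_free_def by blast
qed

text \<open>Greedy choice: \<open>k\<close> slopes block at most \<open>4 * k ^ 5\<close> values,
  fewer than \<open>F\<close> has elements.\<close>

lemma quadrangle_free_exists:
  fixes F :: "'a::field set"
  assumes "(2::'a) \<noteq> 0" "finite F" "4 * k ^ 5 < card F"
  shows "\<exists>S\<subseteq>F. card S = k \<and> quadrangle_free S"
  using assms(3)
proof (induction k)
  case 0
  show ?case by (rule exI[of _ "{}"]) (auto simp: quadrangle_free_def quadrangle_def linked_def)
next
  case (Suc k)
  have "k ^ 5 \<le> Suc k ^ 5" by (rule power_mono) auto
  then have k: "4 * k ^ 5 < card F" using Suc.prems by linarith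
  then obtain S where S: "S \<subseteq> F" "card S = k" "quadrangle_free S" using Suc.IH by auto
  have "finite S" using S assms(2) finite_subset by auto
  then have "card (blocked_slopes S) < card F" "finite (blocked_slopes S)"
    using card_blocked_slopes[OF _ assms(1), of S] S k by auto
  then obtain z where z: "z \<in> F" "z \<notin> blocked_slopes S"
    by (metis card_mono leD subsetI)
  then have "z \<notin> S" by (auto simp: blocked_slopes_def)
  then show ?case
    using S z \<open>finite S\<close> quadrangle_free_insert by (intro exI[of _ "insert z S"]) auto
qed

section \<open>Cliques of linked points\<close>

lemma two_le_cardE:
  assumes "2 \<le> card A"
  obtains x y where "x \<in> A" "y \<in> A" "x \<noteq> y"
  using obtain_subset_with_card_n[OF assms] by (metis card_2_iff insert_subset)

text \<open>If each line held at most \<open>s\<close> points of \<open>Q\<close>, at least two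
  points would lie off any given line, in particular off a fullest one.\<close>

lemma quadrangle_free_clique_line:
  assumes S: "quadrangle_free S" and Q: "finite Q" "s + 2 \<le> card Q" "2 \<le> s"
    and l: "\<And>u v. u \<in> Q \<Longrightarrow> v \<in> Q \<Longrightarrow> u \<noteq> v \<Longrightarrow> linked S u v"
  shows "\<exists>a c. s < card {w \<in> Q. snd w - a * fst w = c}"
proof (rule ccontr)
  define L where "L = (\<lambda>a c. {w \<in> Q. snd w - a * fst w = c})"
  assume "\<not> ?thesis"
  then have le: "card (L a c) \<le> s" for a c by (auto simp: L_def not_less)
  have fin: "finite (L a c)" for a c using Q by (auto simp: L_def)
  \<comment> \<open>Two points off a fullest line \<open>L\<close> and two points of \<open>L\<close> off their join form a quadrangle.\<close>
  obtain a c where ac: "\<And>a' c'. card (L a' c') \<le> card (L a c)"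
  proof -
    have "\<exists>x. True \<and> (\<forall>y. True \<longrightarrow> card (L (fst y) (snd y)) \<le> card (L (fst x) (snd x)))"
      by (rule ex_has_greatest_nat[where b = "Suc s"]) (use le in \<open>auto simp: less_Suc_eq_le\<close>)
    then show ?thesis using that by (metis fst_conv snd_conv)
  qed
  have ft: "fst u \<noteq> fst v" if "u \<in> Q" "v \<in> Q" "u \<noteq> v" for u v
    using l[OF that] by (auto simp: linked_def)
  have line: "snd v - slope u v * fst v = snd u - slope u v * fst u" if "fst u \<noteq> fst v" for u v
  proof -
    have "slope u v * (fst v - fst u) = snd v - snd u" using that by (simp add: slope_def)
    then show ?thesis by Groebner_Basis.algebra
  qed
  have sl: "slope u v = b" if "u \<in> L b e" "v \<in> L b e" "u \<noteq> v" for u v b e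
  proof -
    have "snd v - b * fst v = snd u - b * fst u" using that by (auto simp: L_def)
    then have "snd v - snd u = b * (fst v - fst u)" by Groebner_Basis.algebra
    moreover have "fst u \<noteq> fst v" using that ft by (auto simp: L_def)
    ultimately show ?thesis by (simp add: slope_def)
  qed
  have "2 \<le> card (Q - L a c)"
    using Q le[of a c] fin[of a c] by (subst card_Diff_subset) (auto simp: L_def)
  then obtain p q where pq: "p \<in> Q" "q \<in> Q" "p \<notin> L a c" "q \<notin> L a c" "p \<noteq> q"
    by (elim two_le_cardE) blast
  define M where "M = L (slope p q) (snd p - slope p q * fst p)"
  have pqM: "p \<in> M" "q \<in> M" using pq line[OF ft, of p q] by (auto simp: M_def L_def)
  have card2: "2 \<le> card (L a c)"
  proof -
    have "card {p, q} \<le> card M" using pqM fin by (intro card_mono) (auto simp: M_def)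
    also have "\<dots> \<le> card (L a c)" unfolding M_def by (rule ac)
    finally show ?thesis using pq by simp
  qed
  have one: "card (L a c \<inter> M) \<le> 1"
  proof (rule ccontr)
    assume "\<not> ?thesis"
    then have "2 \<le> card (L a c \<inter> M)" by simp
    then obtain u v where uv: "u \<in> L a c" "v \<in> L a c" "u \<in> M" "v \<in> M" "u \<noteq> v"
      by (elim two_le_cardE) blast
    then have "slope p q = a" using sl unfolding M_def by metis
    then show False using uv pqM pq unfolding M_def L_def by auto
  qed
  \<comment> \<open>The join \<open>M\<close> of \<open>p\<close> and \<open>q\<close> takes at most
    one point \<open>w\<close> from the fullest line. If it takes one, \<open>M\<close> holds
    \<open>p\<close>, \<open>q\<close> and \<open>w\<close>, so the fullest line has at least three
    points and keeps two.\<close>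
  have "2 \<le> card (L a c - M)"
  proof (cases "L a c \<inter> M = {}")
    case True then show ?thesis using card2 by (simp add: Diff_triv)
  next
    case False
    then obtain w where "w \<in> L a c" "w \<in> M" by auto
    then have "card {p, q, w} \<le> card M" "w \<noteq> p" "w \<noteq> q"
      using pq pqM fin by (auto intro!: card_mono simp: M_def)
    moreover from this have "card {p, q, w} = 3" using pq by auto
    moreover have "card M \<le> card (L a c)" unfolding M_def by (rule ac)
    ultimately have "3 \<le> card (L a c)" by linarith
    then show ?thesis using one fin by (simp add: card_Diff_subset_Int)
  qed
  then obtain u v where uv: "u \<in> L a c" "v \<in> L a c" "u \<notin> M" "v \<notin> M" "u \<noteq> v"
    by (elim two_le_cardE) blast
  have Qs: "u \<in> Q" "v \<in> Q" using uv by (auto simp: L_def)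
  have ne: "p \<noteq> u" "p \<noteq> v" "q \<noteq> u" "q \<noteq> v" using uv pqM by auto
  have offM: "slope p q \<noteq> slope p w" if "w \<in> Q" "w \<notin> M" for w
    using line[OF ft, of p w] that pq pqM unfolding M_def L_def by (metis (mono_tags, lifting) mem_Collect_eq)
  have offL: "slope u v \<noteq> slope u w" if "w \<in> Q" "w \<notin> L a c" for w
    using line[OF ft, of u w] that uv Qs sl[OF uv(1,2,5)] unfolding L_def by (metis (mono_tags, lifting) mem_Collect_eq)
  have "noncollinear p q u" "noncollinear p q v"
    using offM Qs uv pq ne ft by (metis noncollinearI)+
  moreover have "noncollinear u v p" "noncollinear u v q"
    using offL Qs uv pq ne ft by (metis noncollinearI)+
  then have "noncollinear p u v" "noncollinear q u v"
    using noncollinear_commute by metis+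
  ultimately have "quadrangle S p q u v"
    unfolding quadrangle_def using l pq ne Qs uv by auto
  then show False using S unfolding quadrangle_free_def by blast
qed

section \<open>Colourings with a rainbow line in every large set\<close>

text \<open>\<open>j\<close> names for every line a colour that \<open>W\<close> is to miss there.
  For each slope, a point of \<open>W\<close> loses exactly one of the \<open>s\<close> colours, and
  the other points keep all.\<close>

lemma card_colourings_avoiding:
  fixes line :: "'a \<Rightarrow> 'b \<Rightarrow> 'c"
  assumes "finite S" "finite P" "W \<subseteq> P" "j \<in> S \<times> L \<rightarrow> {..<s}" "\<And>a u. a \<in> S \<Longrightarrow> u \<in> P \<Longrightarrow> line a u \<in> L"
  shows "card (PiE (S \<times> P) (\<lambda>(a, u). if u \<in> W then {..<s} - {j (a, line a u)} else {..<s})) =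
    (s - 1) ^ (card S * card W) * s ^ (card S * (card P - card W))"
proof -
  have fin: "finite W" "finite (P - W)" using assms finite_subset by auto
  have P: "S \<times> P = S \<times> W \<union> S \<times> (P - W)" using assms(3) by auto
  have c: "card ({..<s} - {j (a, line a u)}) = s - 1" if "a \<in> S" "u \<in> W" for a u
  proof -
    have "j (a, line a u) < s" using that assms(3,5) Pi_mem[OF assms(4), of "(a, line a u)"] by auto
    then show ?thesis by simp
  qed
  have "card (PiE (S \<times> P) (\<lambda>(a, u). if u \<in> W then {..<s} - {j (a, line a u)} else {..<s}))
      = (\<Prod>(a, u) \<in> S \<times> P. if u \<in> W then card ({..<s} - {j (a, line a u)}) else s)"
    using assms(1,2) by (subst card_PiE) (auto intro!: prod.cong)
  also have "\<dots> = (\<Prod>(a, u) \<in> S \<times> W. if u \<in> W then card ({..<s} - {j (a, line a u)}) else s) *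
      (\<Prod>(a, u) \<in> S \<times> (P - W). if u \<in> W then card ({..<s} - {j (a, line a u)}) else s)"
    unfolding P using assms(1) fin by (subst prod.union_disjoint) auto
  also have "\<dots> = (\<Prod>x \<in> S \<times> W. s - 1) * (\<Prod>x \<in> S \<times> (P - W). s)"
    by (intro arg_cong2[of _ _ _ _ "(*)"] prod.cong) (auto simp: c)
  also have "\<dots> = (s - 1) ^ (card S * card W) * s ^ (card S * (card P - card W))"
    using assms(3) fin by (simp add: card_cartesian_product card_Diff_subset)
  finally show ?thesis .
qed

text \<open>Union bound by counting: a colouring that fails on \<open>W\<close> misses some colour
  \<open>j\<close> on every line, hence lies in \<open>bad (W, j)\<close>. \<open>num\<close>
  compares a bound for the number of pairs \<open>(W, j)\<close> times the size of one
  \<open>bad\<close> set with the number of colourings, after cancelling the choices outside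
  \<open>W\<close>.\<close>

lemma rainbow_colouring_exists:
  fixes line :: "'a \<Rightarrow> 'b \<Rightarrow> 'c"
  assumes fin: "finite S" "finite P" "finite L"
    and line: "\<And>a u. a \<in> S \<Longrightarrow> u \<in> P \<Longrightarrow> line a u \<in> L"
    and num: "card P ^ w * s ^ (card S * card L) * (s - 1) ^ (card S * w) < s ^ (card S * w)"
    and "w \<le> card P" "1 \<le> s"
  shows "\<exists>\<chi>. (\<forall>a\<in>S. \<forall>u\<in>P. \<chi> a u < s) \<and>
    (\<forall>W\<subseteq>P. card W = w \<longrightarrow> (\<exists>a\<in>S. \<exists>c\<in>L. \<forall>i<s. \<exists>u\<in>W. line a u = c \<and> \<chi> a u = i))"
proof -
  define C where "C = PiE (S \<times> P) (\<lambda>_. {..<s})"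
  define J where "J = PiE (S \<times> L) (\<lambda>_. {..<s})"
  define Ws where "Ws = {W. W \<subseteq> P \<and> card W = w}"
  define bad where "bad = (\<lambda>(W, j). PiE (S \<times> P) (\<lambda>(a, u). if u \<in> W then {..<s} - {j (a, line a u)} else {..<s}))"
  let ?b = "(s - 1) ^ (card S * w) * s ^ (card S * (card P - w))"
  have finC: "finite C" "finite J" "finite Ws"
    using fin by (auto simp: C_def J_def Ws_def intro!: finite_PiE)
  have bad: "card (bad x) = ?b" "finite (bad x)" if x: "x \<in> Ws \<times> J" for x
  proof -
    obtain W j where x': "x = (W, j)" "W \<subseteq> P" "card W = w" "j \<in> S \<times> L \<rightarrow> {..<s}"
      using x by (auto simp: Ws_def J_def PiE_def)
    show "card (bad x) = ?b"
      using card_colourings_avoiding[OF fin(1,2) x'(2,4) line] x' by (simp add: bad_def)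
    show "finite (bad x)"
      unfolding bad_def x' using fin by (auto intro!: finite_PiE)
  qed
  have "card (\<Union>x\<in>Ws \<times> J. bad x) \<le> (\<Sum>x\<in>Ws \<times> J. card (bad x))"
    using finC by (intro card_UN_le) auto
  also have "\<dots> = card Ws * card J * ?b"
    by (simp add: bad card_cartesian_product)
  also have "\<dots> \<le> (card P ^ w * s ^ (card S * card L)) * ?b"
  proof (intro mult_right_mono mult_mono)
    show "card Ws \<le> card P ^ w"
      unfolding Ws_def using n_subsets[OF fin(2)] binomial_le_pow[OF assms(6)] by simp
    show "card J \<le> s ^ (card S * card L)"
      unfolding J_def using fin by (simp add: card_PiE card_cartesian_product)
  qed auto
  also have "\<dots> = (card P ^ w * s ^ (card S * card L) * (s - 1) ^ (card S * w)) * s ^ (card S * (card P - w))"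
    by simp
  also have "\<dots> < s ^ (card S * w) * s ^ (card S * (card P - w))"
    using num assms(7) by (intro mult_strict_right_mono) auto
  also have "\<dots> = s ^ (card S * card P)"
    using assms(6) by (simp flip: power_add distrib_left)
  also have "\<dots> = card C"
    unfolding C_def using fin by (simp add: card_PiE card_cartesian_product)
  finally have "\<not> C \<subseteq> (\<Union>x\<in>Ws \<times> J. bad x)"
    using card_mono[of "\<Union>x\<in>Ws \<times> J. bad x" C] finC bad(2) by fastforce
  then obtain f where f: "f \<in> C" "\<And>W j. W \<in> Ws \<Longrightarrow> j \<in> J \<Longrightarrow> f \<notin> bad (W, j)" by blast
  define \<chi> where "\<chi> = (\<lambda>a u. f (a, u))"
  have \<chi>: "\<chi> a u < s" if "a \<in> S" "u \<in> P" for a u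
    using f(1) that by (auto simp: C_def \<chi>_def PiE_def Pi_def)
  moreover have "\<exists>a\<in>S. \<exists>c\<in>L. \<forall>i<s. \<exists>u\<in>W. line a u = c \<and> \<chi> a u = i"
    if W: "W \<subseteq> P" "card W = w" for W
  proof (rule ccontr)
    assume no: "\<not> ?thesis"
    have "\<forall>x\<in>S \<times> L. \<exists>i<s. \<forall>u\<in>W. line (fst x) u = snd x \<longrightarrow> \<chi> (fst x) u \<noteq> i"
    proof
      fix x assume "x \<in> S \<times> L"
      then have "fst x \<in> S" "snd x \<in> L" by auto
      with no show "\<exists>i<s. \<forall>u\<in>W. line (fst x) u = snd x \<longrightarrow> \<chi> (fst x) u \<noteq> i" by blast
    qed
    then obtain j where j: "\<And>x. x \<in> S \<times> L \<Longrightarrow> j x < s \<and> (\<forall>u\<in>W. line (fst x) u = snd x \<longrightarrow> \<chi> (fst x) u \<noteq> j x)"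
      by metis
    define j' where "j' = restrict j (S \<times> L)"
    have "j' \<in> J" using j by (auto simp: J_def j'_def)
    moreover have "W \<in> Ws" using W by (simp add: Ws_def)
    moreover have "f \<in> bad (W, j')"
      unfolding bad_def case_prod_conv
    proof (rule PiE_I)
      fix x assume x: "x \<in> S \<times> P"
      obtain a u where au: "x = (a, u)" by (cases x)
      have "a \<in> S" "u \<in> P" using x au by auto
      moreover from this have "f (a, u) < s" using \<chi> by (simp add: \<chi>_def)
      moreover have "f (a, u) \<noteq> j' (a, line a u)" if "u \<in> W"
      proof -
        have "(a, line a u) \<in> S \<times> L" using line \<open>a \<in> S\<close> \<open>u \<in> P\<close> by auto
        then show ?thesis using j[of "(a, line a u)"] that by (simp add: j'_def \<chi>_def)
      qed
      ultimately show "f x \<in> (case x of (a, u) \<Rightarrow> if u \<in> W then {..<s} - {j' (a, line a u)} else {..<s})"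
        by (auto simp: au)
    next
      fix x assume "x \<notin> S \<times> P"
      then show "f x = undefined" using f(1) unfolding C_def by (rule PiE_arb[rotated])
    qed
    ultimately show False using f(2) by blast
  qed
  ultimately show ?thesis by blast
qed

section \<open>The graph\<close>

lemma contains_completeE:
  assumes "contains_complete r (with_proj G)"
  obtains A where "A \<subseteq> pverts G" "card A = r" "\<And>u v. u \<in> A \<Longrightarrow> v \<in> A \<Longrightarrow> u \<noteq> v \<Longrightarrow> (u, v) \<in> parcs G"
proof -
  obtain H where H: "subgraph H (with_proj G)" "K\<^bsub>r\<^esub> H"
    using assms by (auto simp: contains_complete_def)
  show thesis
  proof
    show "verts H \<subseteq> pverts G" using H(1) by (auto simp: subgraph_def)
    show "card (verts H) = r" using H(2) by (simp add: complete_digraph_def)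
    fix u v assume "u \<in> verts H" "v \<in> verts H" "u \<noteq> v"
    then have "(u, v) \<in> arcs_ends H" using H(2) by (auto simp: complete_digraph_def)
    then obtain e where "e \<in> arcs H" "tail H e = u" "head H e = v"
      by (auto simp: arcs_ends_def arc_to_ends_def)
    moreover have "tail H = fst" "head H = snd" "arcs H \<subseteq> parcs G"
      using H(1) by (auto simp: subgraph_def compatible_def)
    ultimately show "(u, v) \<in> parcs G" by auto
  qed
qed

lemma contains_completeI:
  assumes "pair_graph G" "A \<subseteq> W" "W \<subseteq> pverts G" "card A = r"
    and A: "\<And>u v. u \<in> A \<Longrightarrow> v \<in> A \<Longrightarrow> u \<noteq> v \<Longrightarrow> (u, v) \<in> parcs G"
  shows "contains_complete r (with_proj G \<restriction> W)"
proof -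
  interpret pair_graph G by fact
  define H where "H = \<lparr>pverts = A, parcs = {(u, v). (u, v) \<in> A \<times> A \<and> u \<noteq> v}\<rparr>"
  have "finite A" using assms pair_finite_verts finite_subset by metis
  then have K: "K\<^bsub>r\<^esub> (with_proj H)"
    using assms(4) by (simp add: complete_digraph_pair_def H_def)
  have "wf_digraph (with_proj H)"
    by unfold_locales (auto simp: H_def)
  moreover have "wf_digraph (with_proj G \<restriction> W)"
    by (rule wellformed_induce_subgraph)
  ultimately have "subgraph (with_proj H) (with_proj G \<restriction> W)"
    using assms(2) A by (auto simp: subgraph_def compatible_def H_def)
  then show ?thesis using K unfolding contains_complete_def by blast
qed

text \<open>A bijection \<open>h\<close> numbers the points, because vertices are natural numbers.
  In \<open>rich\<close>, sets of exactly \<open>w\<close> points suffice, since every larger set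
  contains one.\<close>

lemma erdos_rogers_le_of_relation:
  fixes V :: "'b set"
  assumes V: "finite V" "card V = n" and s: "1 \<le> s"
    and sym: "\<And>u v. E u v \<Longrightarrow> E v u"
    and free: "\<And>Q. Q \<subseteq> V \<Longrightarrow> card Q = t \<Longrightarrow> \<exists>u\<in>Q. \<exists>v\<in>Q. u \<noteq> v \<and> \<not> E u v"
    and rich: "\<And>W. W \<subseteq> V \<Longrightarrow> card W = w \<Longrightarrow> \<exists>A\<subseteq>W. card A = s \<and> (\<forall>u\<in>A. \<forall>v\<in>A. u \<noteq> v \<longrightarrow> E u v)"
  shows "erdos_rogers s t n \<le> w"
proof -
  obtain h where h: "bij_betw h {..<n} V"
    using V by (metis bij_betw_from_nat_into_finite)
  then have inj: "inj_on h {..<n}" by (simp add: bij_betw_def)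
  define G where "G = \<lparr>pverts = {..<n}, parcs = {(i, j). i < n \<and> j < n \<and> i \<noteq> j \<and> E (h i) (h j)}\<rparr>"
  have G: "pair_graph G"
    by unfold_locales (auto simp: G_def symmetric_def intro!: symI sym intro: finite_subset[of _ "{..<n} \<times> {..<n}"])
  have "\<not> contains_complete t (with_proj G)"
  proof
    assume "contains_complete t (with_proj G)"
    then obtain A where A: "A \<subseteq> pverts G" "card A = t"
      "\<And>u v. u \<in> A \<Longrightarrow> v \<in> A \<Longrightarrow> u \<noteq> v \<Longrightarrow> (u, v) \<in> parcs G"
      using contains_completeE by metis
    have "h ` A \<subseteq> V" "card (h ` A) = t"
      using A h inj by (auto simp: G_def bij_betw_def card_image inj_on_subset)
    then show False using free[of "h ` A"] A(3) by (fastforce simp: G_def)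
  qed
  then have "G \<in> free_graphs t n" using G by (simp add: free_graphs_def) (simp add: G_def)
  then have "erdos_rogers s t n \<le> free_number s G"
    unfolding erdos_rogers_def by (intro Min_le free_number_image_finite s) auto
  also have "\<dots> \<le> w"
    unfolding free_number_def
  proof (intro Max.boundedI)
    show "finite (card ` {W. W \<subseteq> pverts G \<and> \<not> contains_complete s (with_proj G \<restriction> W)})"
      using free_number_sets_finite[OF G] by simp
    show "card ` {W. W \<subseteq> pverts G \<and> \<not> contains_complete s (with_proj G \<restriction> W)} \<noteq> {}"
      using free_number_sets_nonempty[OF s, of G] by simp
    fix x assume "x \<in> card ` {W. W \<subseteq> pverts G \<and> \<not> contains_complete s (with_proj G \<restriction> W)}"
    then obtain W where W: "W \<subseteq> {..<n}" "\<not> contains_complete s (with_proj G \<restriction> W)" "x = card W"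
      by (auto simp: G_def)
    show "x \<le> w"
    proof (rule ccontr)
      assume "\<not> x \<le> w"
      then obtain W' where W': "W' \<subseteq> W" "card W' = w"
        using obtain_subset_with_card_n[of w W] W(3) by auto
      have "h ` W' \<subseteq> V" "card (h ` W') = w"
        using W' W(1) h inj by (auto simp: bij_betw_def card_image inj_on_subset)
      then obtain A where A: "A \<subseteq> h ` W'" "card A = s" "\<forall>u\<in>A. \<forall>v\<in>A. u \<noteq> v \<longrightarrow> E u v"
        using rich by blast
      then obtain B where B: "B \<subseteq> W'" "A = h ` B" by (auto simp: subset_image_iff)
      have injB: "inj_on h B" using inj B(1) W'(1) W(1) by (meson inj_on_subset subset_trans)
      have "contains_complete s (with_proj G \<restriction> W)"
      proof (rule contains_completeI[OF G])
        show "B \<subseteq> W" using B W' by auto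
        show "W \<subseteq> pverts G" using W by (simp add: G_def)
        show "card B = s" using A(2) B(2) injB by (simp add: card_image)
        show "(u, v) \<in> parcs G" if "u \<in> B" "v \<in> B" "u \<noteq> v" for u v
          using that A(3) injB \<open>B \<subseteq> W\<close> W(1) unfolding B(2) inj_on_def by (auto simp: G_def)
      qed
      then show False using W(2) by simp
    qed
  qed
  finally show ?thesis .
qed

section \<open>The coloured plane as a graph\<close>

lemma slope_eqI:
  assumes "fst u \<noteq> fst v" "snd u - a * fst u = snd v - a * fst v"
  shows "slope u v = a"
proof -
  have "snd v - snd u = a * (fst v - fst u)" using assms(2) by (simp add: algebra_simps)
  then show ?thesis using assms(1) by (simp add: slope_def)
qed

text \<open>Any \<open>n\<close> points of the plane serve as vertices, as both properties of the
  graph pass to subsets. \<open>num\<close> is the counting condition for \<open>card F ^ 2\<close>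
  points and \<open>card F\<close> intercepts.\<close>

lemma erdos_rogers_le_of_plane:
  fixes F S :: "'a::field set"
  assumes F: "finite F" "\<And>a x y. a \<in> F \<Longrightarrow> x \<in> F \<Longrightarrow> y \<in> F \<Longrightarrow> y - a * x \<in> F"
    and S: "S \<subseteq> F" "quadrangle_free S" and s: "2 \<le> s"
    and n: "n \<le> card F ^ 2" and w: "w \<le> card F ^ 2"
    and num: "card F ^ (2 * w) * s ^ (card S * card F) * (s - 1) ^ (card S * w) < s ^ (card S * w)"
  shows "erdos_rogers s (s + 2) n \<le> w"
proof -
  have P: "card (F \<times> F) = card F ^ 2" by (simp add: card_cartesian_product power2_eq_square)
  define line :: "'a \<Rightarrow> 'a \<times> 'a \<Rightarrow> 'a" where "line = (\<lambda>a u. snd u - a * fst u)"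
  have "\<exists>\<chi>. (\<forall>a\<in>S. \<forall>u\<in>F \<times> F. \<chi> a u < s) \<and>
    (\<forall>W\<subseteq>F \<times> F. card W = w \<longrightarrow> (\<exists>a\<in>S. \<exists>c\<in>F. \<forall>i<s. \<exists>u\<in>W. line a u = c \<and> \<chi> a u = i))"
  proof (rule rainbow_colouring_exists)
    show "line a u \<in> F" if "a \<in> S" "u \<in> F \<times> F" for a u
      using that F(2) S(1) by (auto simp: line_def)
    show "card (F \<times> F) ^ w * s ^ (card S * card F) * (s - 1) ^ (card S * w) < s ^ (card S * w)"
      using num by (simp add: P flip: power_mult)
  qed (use F S s w P finite_subset in auto)
  then obtain \<chi> where \<chi>0: "(\<forall>a\<in>S. \<forall>u\<in>F \<times> F. \<chi> a u < s) \<and>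
    (\<forall>W\<subseteq>F \<times> F. card W = w \<longrightarrow> (\<exists>a\<in>S. \<exists>c\<in>F. \<forall>i<s. \<exists>u\<in>W. line a u = c \<and> \<chi> a u = i))" ..
  have \<chi>1: "\<chi> a u < s" if "a \<in> S" "u \<in> F \<times> F" for a u
    using \<chi>0[THEN conjunct1, rule_format, OF that] .
  have \<chi>2: "\<exists>a\<in>S. \<exists>c\<in>F. \<forall>i<s. \<exists>u\<in>W. line a u = c \<and> \<chi> a u = i" if "W \<subseteq> F \<times> F" "card W = w" for W
    using \<chi>0[THEN conjunct2, rule_format, OF that] .
  obtain V where V: "V \<subseteq> F \<times> F" "card V = n"
    using obtain_subset_with_card_n[of n "F \<times> F"] n P by metis
  define E where "E = (\<lambda>u v. linked S u v \<and> \<chi> (slope u v) u \<noteq> \<chi> (slope u v) v)"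
  show ?thesis
  proof (rule erdos_rogers_le_of_relation[where E = E and V = V])
    show "finite V" using V(1) F(1) finite_subset by blast
    show "E v u" if "E u v" for u v
      using that unfolding E_def by (metis linked_commute slope_commute)
    show "\<exists>u\<in>Q. \<exists>v\<in>Q. u \<noteq> v \<and> \<not> E u v" if Q: "Q \<subseteq> V" "card Q = s + 2" for Q
    proof (rule ccontr)
      assume "\<not> ?thesis"
      then have cl: "E u v" if "u \<in> Q" "v \<in> Q" "u \<noteq> v" for u v using that by blast
      have finQ: "finite Q" using Q(2) card.infinite by fastforce
      obtain a c where ac: "s < card {w \<in> Q. snd w - a * fst w = c}"
        using quadrangle_free_clique_line[OF S(2) finQ, of s] Q(2) s cl unfolding E_def by auto
      let ?L = "{w \<in> Q. snd w - a * fst w = c}"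
      have sl: "slope u v = a" if "u \<in> ?L" "v \<in> ?L" "u \<noteq> v" for u v
        using slope_eqI[of u v a] that cl[of u v] by (auto simp: E_def linked_def)
      \<comment> \<open>Two points of the line, being linked with slope \<open>a\<close>, put
        \<open>a\<close> into \<open>S\<close>; this is what bounds the colours for \<open>a\<close>
        by \<open>s\<close>.\<close>
      have "2 \<le> card ?L" using ac s by linarith
      then obtain u v where "u \<in> ?L" "v \<in> ?L" "u \<noteq> v" by (rule two_le_cardE)
      then have "a \<in> S" using sl[of u v] cl[of u v] by (auto simp: E_def linked_def)
      have "inj_on (\<chi> a) ?L"
      proof (rule inj_onI, rule ccontr)
        fix u v assume *: "u \<in> ?L" "v \<in> ?L" "\<chi> a u = \<chi> a v" "u \<noteq> v"
        then show False using sl[of u v] cl[of u v] by (auto simp: E_def)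
      qed
      moreover have "\<chi> a ` ?L \<subseteq> {..<s}"
        using \<chi>1 \<open>a \<in> S\<close> Q(1) V(1) by auto
      ultimately have "card ?L \<le> card {..<s}" by (intro card_inj_on_le) auto
      then show False using ac by simp
    qed
    show "\<exists>A\<subseteq>W. card A = s \<and> (\<forall>u\<in>A. \<forall>v\<in>A. u \<noteq> v \<longrightarrow> E u v)" if W: "W \<subseteq> V" "card W = w" for W
    proof -
      obtain a c where a: "a \<in> S" "\<forall>i<s. \<exists>u\<in>W. line a u = c \<and> \<chi> a u = i"
        using \<chi>2[of W] W V(1) by blast
      then obtain f where f: "\<And>i. i < s \<Longrightarrow> f i \<in> W \<and> line a (f i) = c \<and> \<chi> a (f i) = i"
        by metis
      have "inj_on f {..<s}" using f by (metis inj_onI lessThan_iff)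
      then have "card (f ` {..<s}) = s" by (simp add: card_image)
      moreover have "E (f i) (f j)" if ij: "i < s" "j < s" "f i \<noteq> f j" for i j
      proof -
        have l: "snd (f i) - a * fst (f i) = snd (f j) - a * fst (f j)"
          using f[OF ij(1)] f[OF ij(2)] by (simp add: line_def)
        have ne: "fst (f i) \<noteq> fst (f j)"
        proof
          assume e: "fst (f i) = fst (f j)"
          with l have "snd (f i) = snd (f j)" by simp
          with e ij(3) show False by (simp add: prod_eq_iff)
        qed
        have "slope (f i) (f j) = a" using slope_eqI[OF ne l] .
        moreover have "i \<noteq> j" using ij by auto
        ultimately show ?thesis using ne f[OF ij(1)] f[OF ij(2)] a(1) by (simp add: E_def linked_def)
      qed
      ultimately show ?thesis using f by (intro exI[of _ "f ` {..<s}"]) auto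
    qed
  qed (use V s in auto)
qed

section \<open>Choice of the parameters\<close>

lemma power_gap:
  assumes "1 \<le> s" "1 \<le> (c::nat)"
  obtains k where "1 \<le> k" "c * (s - 1) ^ k < s ^ k"
proof -
  \<comment> \<open>The base \<open>1 - 1 / s\<close> is nonnegative and less than 1.\<close>
  have "(\<lambda>k. ((real s - 1) / real s) ^ k) \<longlonglongrightarrow> 0"
    using assms by (intro LIMSEQ_power_zero) simp
  then have "\<forall>\<^sub>F k in sequentially. ((real s - 1) / real s) ^ k < 1 / c"
    using assms by (intro order_tendstoD(2)) auto
  then have "\<forall>\<^sub>F k in sequentially. ((real s - 1) / real s) ^ k < 1 / c \<and> 1 \<le> k"
    using eventually_ge_at_top[of 1] by eventually_elim auto
  then obtain k where k: "((real s - 1) / real s) ^ k < 1 / c" "1 \<le> k"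
    using eventually_happens[of _ sequentially] by auto
  then have "real c * (real s - 1) ^ k < real s ^ k"
    using assms by (simp add: power_divide field_simps)
  then have "real (c * (s - 1) ^ k) < real (s ^ k)"
    using assms by (simp add: of_nat_diff)
  then show ?thesis using that k by (simp only: of_nat_less_iff)
qed

lemma erdos_rogers_le:
  assumes "1 \<le> s" "2 \<le> t"
  shows "erdos_rogers s t n \<le> n"
proof -
  obtain G where G: "G \<in> free_graphs t n" using free_graphs_nonempty[OF assms(2)] by blast
  then have "erdos_rogers s t n \<le> free_number s G"
    unfolding erdos_rogers_def by (intro Min_le free_number_image_finite assms) auto
  also have "\<dots> \<le> n" using free_number_le[OF _ assms(1), of G] G by (simp add: free_graphs_def)
  finally show ?thesis .
qed

text \<open>With \<open>q = 3 ^ m\<close>, \<open>k = K * m\<close> slopes and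
  \<open>w = 2 * D * q\<close>, half of the exponent \<open>k * w\<close> pays, by the choice of
  \<open>D\<close>, for the \<open>s ^ (k * q)\<close> choices of missing colours. The other half
  pays, by the choice of \<open>K\<close>, for the bound \<open>q ^ (2 * w)\<close> on the number of
  sets \<open>W\<close>. The bounds on \<open>m\<close> leave room for the greedy choice and give
  \<open>w \<le> q ^ 2\<close>.\<close>

lemma erdos_rogers_le_linear:
  assumes s: "2 \<le> s" and D: "s * (s - 1) ^ D < s ^ D" and K: "81 * (s - 1) ^ K < s ^ K"
    and m: "1 \<le> m" "4 * (K * m) ^ 5 < 3 ^ m" "2 * D \<le> 3 ^ m" "1 \<le> D" and n: "n \<le> (3 ^ m)\<^sup>2"
  shows "erdos_rogers s (s + 2) n \<le> 2 * D * 3 ^ m"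
proof -
  obtain F :: "three mod_ring alg_closure set"
    where F: "card F = 3 ^ m" "\<And>a x y. a \<in> F \<Longrightarrow> x \<in> F \<Longrightarrow> y \<in> F \<Longrightarrow> y - a * x \<in> F"
    using finite_field_three_power[OF m(1)] by blast
  have finF: "finite F" using F(1) card.infinite by fastforce
  obtain S where S: "S \<subseteq> F" "card S = K * m" "quadrangle_free S"
    using quadrangle_free_exists[OF two_neq_zero finF, of "K * m"] m(2) F(1) by auto
  define q :: nat where "q = 3 ^ m"
  define k where "k = K * m"
  have q: "1 \<le> q" by (simp add: q_def)
  have 1: "(s * (s - 1) ^ D) ^ (k * q) \<le> (s ^ D) ^ (k * q)"
    using D by (intro power_mono) auto
  \<comment> \<open>The constant 81 is \<open>3 ^ 4\<close>, so its \<open>m\<close>-th power is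
    \<open>q ^ 4\<close>, and \<open>q ^ (2 * w)\<close> is a power of that.\<close>
  have "q ^ 4 * (s - 1) ^ k = (81 * (s - 1) ^ K) ^ m"
  proof -
    have "q ^ 4 = (3 ^ 4) ^ m" unfolding q_def by (simp only: power_mult[symmetric] mult.commute)
    then show ?thesis by (simp add: k_def power_mult_distrib power_mult)
  qed
  also have "\<dots> < (s ^ K) ^ m"
    using K m(1) by (intro power_strict_mono) auto
  finally have "q ^ 4 * (s - 1) ^ k < s ^ k" by (simp add: k_def power_mult)
  then have 2: "(q ^ 4 * (s - 1) ^ k) ^ (D * q) < (s ^ k) ^ (D * q)"
    using m(4) q by (intro power_strict_mono) auto
  have e1: "q ^ (2 * (2 * D * q)) = (q ^ 4) ^ (D * q)"
    by (simp add: mult_ac flip: power_mult)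
  have e2: "(s - 1) ^ (k * (2 * D * q)) = ((s - 1) ^ D) ^ (k * q) * ((s - 1) ^ k) ^ (D * q)"
    by (simp add: algebra_simps mult_2_right flip: power_mult power_add)
  have "q ^ (2 * (2 * D * q)) * s ^ (k * q) * (s - 1) ^ (k * (2 * D * q))
      = (s * (s - 1) ^ D) ^ (k * q) * (q ^ 4 * (s - 1) ^ k) ^ (D * q)"
    unfolding e1 e2 power_mult_distrib by (simp only: mult_ac)
  also have "\<dots> < (s ^ D) ^ (k * q) * (s ^ k) ^ (D * q)"
    using 1 2 s by (intro mult_le_less_imp_less) auto
  also have "\<dots> = s ^ (k * (2 * D * q))"
    by (simp add: algebra_simps mult_2_right flip: power_mult power_add)
  finally have num: "q ^ (2 * (2 * D * q)) * s ^ (k * q) * (s - 1) ^ (k * (2 * D * q)) < s ^ (k * (2 * D * q))" .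
  show ?thesis
  proof (rule erdos_rogers_le_of_plane[OF finF F(2) S(1,3) s])
    show "n \<le> card F ^ 2" using n F by simp
    show "2 * D * 3 ^ m \<le> card F ^ 2" using m(3) F by (simp add: power2_eq_square)
    show "card F ^ (2 * (2 * D * 3 ^ m)) * s ^ (card S * card F) * (s - 1) ^ (card S * (2 * D * 3 ^ m)) <
        s ^ (card S * (2 * D * 3 ^ m))"
      using num unfolding F(1) S(2) q_def k_def .
  qed
qed

theorem theorem2:
  fixes s :: nat
  assumes "4 \<le> s"
  shows "\<exists>c::real. 0 < c \<and> (\<forall>n::nat. 1 \<le> n \<longrightarrow> real (erdos_rogers s (s + 2) n) \<le> c * sqrt (real n))"
proof -
  have s: "1 \<le> s" "2 \<le> s" using assms by auto
  obtain D where D: "1 \<le> D" "s * (s - 1) ^ D < s ^ D" using power_gap[OF s(1) s(1)] by blast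
  obtain K where K: "1 \<le> K" "81 * (s - 1) ^ K < s ^ K" using power_gap[OF s(1), of 81] by auto
  have pos: "0 < real K" "0 < real D" using K(1) D(1) by auto
  have "\<forall>\<^sub>F m in sequentially. 4 * (real K * real m) ^ 5 < 3 ^ m"
    using pos by real_asymp
  moreover have "\<forall>\<^sub>F m in sequentially. 2 * real D \<le> 3 ^ m"
    using pos by real_asymp
  ultimately have "\<forall>\<^sub>F m in sequentially. 4 * (K * m) ^ 5 < 3 ^ m \<and> 2 * D \<le> 3 ^ m"
  proof eventually_elim
    case (elim m)
    then have "real (4 * (K * m) ^ 5) < real (3 ^ m)" "real (2 * D) \<le> real (3 ^ m)" by simp_all
    then show ?case by (simp only: of_nat_less_iff of_nat_le_iff)
  qed
  then obtain m0 where m0: "\<And>m. m \<ge> m0 \<Longrightarrow> 4 * (K * m) ^ 5 < 3 ^ m \<and> 2 * D \<le> 3 ^ m"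
    by (auto simp: eventually_sequentially)
  \<comment> \<open>The first term comes from \<open>2 * D * 3 ^ m\<close> and
    \<open>3 ^ m \<le> 3 * sqrt n\<close>. The second covers small \<open>n\<close>, where
    \<open>sqrt n \<le> 3 ^ m0\<close> and the trivial bound \<open>n\<close> is
    \<open>sqrt n * sqrt n\<close>.\<close>
  define c :: real where "c = 6 * real D + 3 ^ m0"
  have "real (erdos_rogers s (s + 2) n) \<le> c * sqrt n" if n: "1 \<le> n" for n
  proof -
    define m where "m = (LEAST m. n \<le> (3 ^ m)\<^sup>2)"
    have "n \<le> (3 ^ n)\<^sup>2"
      using less_exp[of n] power_mono[of 2 "3::nat" n] self_le_power[of "3 ^ n :: nat" 2] by linarith
    then have m: "n \<le> (3 ^ m)\<^sup>2" unfolding m_def by (rule LeastI)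
    show ?thesis
    proof (cases "m0 \<le> m \<and> 1 \<le> m")
      case True
      \<comment> \<open>Minimality applies to \<open>m - 1\<close>, which lies below
        \<open>m\<close> only because \<open>1 \<le> m\<close>.\<close>
      then have "\<not> n \<le> (3 ^ (m - 1))\<^sup>2" unfolding m_def by (intro not_less_Least) auto
      then have "real ((3 ^ (m - 1))\<^sup>2) \<le> real n" by (simp only: of_nat_le_iff)
      then have "3 ^ (m - 1) \<le> sqrt n" by (intro real_le_rsqrt) simp
      moreover have "(3::real) ^ m = 3 * 3 ^ (m - 1)" using True by (cases m) auto
      ultimately have "3 ^ m \<le> 3 * sqrt n" by simp
      then have "real (2 * D) * 3 ^ m \<le> real (2 * D) * (3 * sqrt n)" by (intro mult_left_mono) auto
      moreover have "erdos_rogers s (s + 2) n \<le> 2 * D * 3 ^ m"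
        using erdos_rogers_le_linear[OF s(2) D(2) K(2), of m n] True m m0 D(1) by auto
      then have "real (erdos_rogers s (s + 2) n) \<le> real (2 * D * 3 ^ m)" by (simp only: of_nat_le_iff)
      ultimately have "real (erdos_rogers s (s + 2) n) \<le> 6 * D * sqrt n" by simp
      also have "\<dots> \<le> c * sqrt n" unfolding c_def by (intro mult_right_mono) auto
      finally show ?thesis .
    next
      case False
      \<comment> \<open>The case \<open>m = 0\<close> falls here too.\<close>
      then have "m \<le> m0" using not_less_eq_eq by auto
      then have "(3::nat) ^ m \<le> 3 ^ m0" by (intro power_increasing) auto
      then have "((3::nat) ^ m)\<^sup>2 \<le> (3 ^ m0)\<^sup>2" by (intro power_mono) auto
      then have "n \<le> (3 ^ m0)\<^sup>2" using m by linarith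
      then have "real n \<le> real ((3 ^ m0)\<^sup>2)" by (simp only: of_nat_le_iff)
      then have "sqrt n \<le> 3 ^ m0" by (intro real_le_lsqrt) auto
      then have "sqrt n * sqrt n \<le> c * sqrt n"
        unfolding c_def by (intro mult_right_mono) (auto intro: add_increasing)
      moreover have "real (erdos_rogers s (s + 2) n) \<le> real n"
        using erdos_rogers_le[OF s(1), of "s + 2" n] by simp
      ultimately show ?thesis by simp
    qed
  qed
  moreover have "0 < c" by (simp add: c_def add_nonneg_pos)
  ultimately show ?thesis by blast
qed

end
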